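(* Let $\alpha$ be a polynomial curve of degree $5$ in $\mathbb{R}^3$. Then $\alpha$ is a helix if and only if $\alpha$ is a $2$-PH curve, that is, if and only if both $\|\alpha'\|$ and $\|\alpha'\wedge\alpha''\|$ are polynomial functions.
   Context: A polynomial curve of degree $5$ (quintic polynomial curve) in $\mathbb{R}^3$ is a map $\alpha(t)=(x(t),y(t),z(t))$ whose components are real polynomials with maximal degree $5$. The symbol $\wedge$ is the cross product in $\mathbb{R}^3$ and $\|\cdot\|$ is the Euclidean norm. A curve $\alpha$ is a helix (also called a generalized helix, or curve of constant slope) if its tangent makes a constant angle with a fixed direction: there are a unit vector $\overrightarrow{u}\in\mathbb{R}^3$ and a constant $c\in\mathbb{R}$ such that $\langle \overrightarrow{u},\overrightarrow{t}\rangle=c$, where $\overrightarrow{t}=\alpha'/\|\alpha'\|$ is the tangent vector. A Pythagorean hodograph curve of second class ($2$-PH curve) is a curve $\alpha$ for which both $\|\alpha'\|$ and $\|\alpha'\wedge\alpha''\|$ are polynomial functions. Here "$\|\alpha'\|$ is a polynomial function" means that $\|\alpha'\|^2$ is the perfect square of a real polynomial, and "$\|\alpha'\wedge\alpha''\|$ is a polynomial function" means that $\|\alpha'\wedge\alpha''\|^2$ is the perfect square of a real polynomial.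
   Formalization: The curve is additionally assumed regular (α' never zero, so the tangent is defined everywhere) and not contained in a plane; e.g. the planar quintic (t, t^5, 0) is a helix with c = 0 but ‖α'‖ is not polynomial. *)

theory Defs
  imports "HOL-Analysis.Analysis" "HOL-Computational_Algebra.Polynomial"
begin

definition polynomial_curve :: "nat \<Rightarrow> (real \<Rightarrow> real^3) \<Rightarrow> bool" where
  "polynomial_curve n \<alpha> \<longleftrightarrow>
     (\<exists>x y z :: real poly.
        (\<forall>t. \<alpha> t = vector [poly x t, poly y t, poly z t]) \<and>
        Max {degree x, degree y, degree z} = n)"

definition velocity :: "(real \<Rightarrow> real^3) \<Rightarrow> real \<Rightarrow> real^3" where
  "velocity \<alpha> t = vector_derivative \<alpha> (at t)"

definition acceleration :: "(real \<Rightarrow> real^3) \<Rightarrow> real \<Rightarrow> real^3" where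
  "acceleration \<alpha> = velocity (velocity \<alpha>)"

definition regular_curve :: "(real \<Rightarrow> real^3) \<Rightarrow> bool" where
  "regular_curve \<alpha> \<longleftrightarrow> (\<forall>t. velocity \<alpha> t \<noteq> 0)"

definition planar_curve :: "(real \<Rightarrow> real^3) \<Rightarrow> bool" where
  "planar_curve \<alpha> \<longleftrightarrow> (\<exists>n d. n \<noteq> 0 \<and> (\<forall>t. n \<bullet> \<alpha> t = d))"

(* Meaningful for regular curves only: where the velocity vanishes, the value is 0. *)
definition tangent_vector :: "(real \<Rightarrow> real^3) \<Rightarrow> real \<Rightarrow> real^3" where
  "tangent_vector \<alpha> t = velocity \<alpha> t /\<^sub>R norm (velocity \<alpha> t)"

(* The value c = 0 is allowed, so every planar regular curve is a helix in this sense
   (take u normal to the plane). *)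
definition helix :: "(real \<Rightarrow> real^3) \<Rightarrow> bool" where
  "helix \<alpha> \<longleftrightarrow> (\<exists>u c. norm u = 1 \<and> (\<forall>t. u \<bullet> tangent_vector \<alpha> t = c))"

(* The squared norm is the square of a real polynomial q; since q may change sign,
   the norm itself is then the absolute value of q. *)
definition polynomial_norm :: "(real \<Rightarrow> real^3) \<Rightarrow> bool" where
  "polynomial_norm f \<longleftrightarrow> (\<exists>q :: real poly. \<forall>t. (norm (f t))\<^sup>2 = (poly q t)\<^sup>2)"

definition two_PH_curve :: "(real \<Rightarrow> real^3) \<Rightarrow> bool" where
  "two_PH_curve \<alpha> \<longleftrightarrow>
     polynomial_norm (velocity \<alpha>) \<and>
     polynomial_norm (\<lambda>t. cross3 (velocity \<alpha> t) (acceleration \<alpha> t))"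

end

theory Submission
  imports Defs "HOL-Computational_Algebra.Polynomial_Factorial" "HOL-Computational_Algebra.Field_as_Ring"
begin

text \<open>
  Write \<open>v = (x', y', z')\<close> for the velocity and \<open>s\<close> for a polynomial with \<open>s\<^sup>2 = |v|\<^sup>2\<close>. In both directions
  the helix condition is read as a linear relation between the three components of \<open>v\<close> and \<open>s\<close>.

  A helix satisfies \<open>u \<bullet> v = c |v|\<close>. If \<open>c = 0\<close> or \<open>c\<^sup>2 = 1\<close>, then \<open>v\<close> stays orthogonal to a fixed
  vector and the curve is planar. Otherwise \<open>|v| = (u \<bullet> v) / c\<close> is a polynomial, and the Gram
  determinant of \<open>u, v, v'\<close> gives \<open>(u \<bullet> (v \<times> v'))\<^sup>2 = (1 - c\<^sup>2) |v \<times> v'|\<^sup>2\<close>, so \<open>|v \<times> v'|\<close> is, up to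
  a constant and a sign, the polynomial \<open>u \<bullet> (v \<times> v')\<close> (\<open>helix_imp_two_PH\<close>).

  For the converse, \<open>V = (v, s)\<close> is a polynomial curve of degree at most 4 on the light cone of
  Minkowski space \<open>\<real>\<^sup>4\<close> with form \<open>\<langle>_, _\<rangle>\<close> of signature (3,1). Because \<open>v \<bullet> v' = s s'\<close>, we have
  \<open>|v \<times> v'|\<^sup>2 = s\<^sup>2 (|v'|\<^sup>2 - s'\<^sup>2)\<close>. If the left side is a perfect square, then
  \<open>\<langle>V', V'\<rangle> = g\<^sup>2\<close> for a polynomial \<open>g\<close> (\<open>speed_dvd_cross_norm\<close>), and \<open>\<langle>V, V\<rangle> = 0\<close> forces
  \<open>deg g \<le> 2\<close>. Let \<open>g = a + b t + c t\<^sup>2\<close>. Comparing coefficients in \<open>\<langle>V, V\<rangle> = 0\<close> and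
  \<open>\<langle>V', V'\<rangle> = g\<^sup>2\<close> determines the 5 by 5 Gram matrix of the coefficient vectors \<open>p\<^sub>0, \<dots>, p\<^sub>4\<close> of \<open>V\<close>,
  except for the one parameter \<open>e = \<langle>p\<^sub>0, p\<^sub>4\<rangle>\<close>. Five vectors in \<open>\<real>\<^sup>4\<close> are dependent, so this matrix
  is singular, and its determinant is a multiple of
  \<open>(2e + ac)\<^sup>2 (8e + b\<^sup>2)\<^sup>2 (6e + b\<^sup>2 - ac)\<close>. At the two double roots its rank is at most 3. At the
  simple root its principal 4 by 4 minors are squares, whereas the signature of the form makes
  every Gram determinant of four vectors the negative of a square. So all these minors vanish, and the
  \<open>p\<^sub>i\<close> lie in a hyperplane (\<open>null_curve_gram_normal\<close>). Hence some fixed nonzero \<open>l\<close> satisfies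
  \<open>l\<^sub>1 x' + l\<^sub>2 y' + l\<^sub>3 z' + l\<^sub>4 s = 0\<close>. As \<open>s\<close> has no real zero, it has constant sign, and dividing by
  \<open>|v| = |s|\<close> shows that the tangent makes a constant angle with \<open>(l\<^sub>1, l\<^sub>2, l\<^sub>3)\<close>.
\<close>

section \<open>Gram determinants in Minkowski space\<close>

definition lorentz :: "real^4 \<Rightarrow> real^4 \<Rightarrow> real" where
  "lorentz x y = x$1 * y$1 + x$2 * y$2 + x$3 * y$3 - x$4 * y$4"

lemma det_4:
  "det (A::'a::comm_ring_1^4^4) =
    A$1$1 * A$2$2 * A$3$3 * A$4$4 - A$1$1 * A$2$2 * A$3$4 * A$4$3
  - A$1$1 * A$2$3 * A$3$2 * A$4$4 + A$1$1 * A$2$3 * A$3$4 * A$4$2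
  + A$1$1 * A$2$4 * A$3$2 * A$4$3 - A$1$1 * A$2$4 * A$3$3 * A$4$2
  - A$1$2 * A$2$1 * A$3$3 * A$4$4 + A$1$2 * A$2$1 * A$3$4 * A$4$3
  + A$1$2 * A$2$3 * A$3$1 * A$4$4 - A$1$2 * A$2$3 * A$3$4 * A$4$1
  - A$1$2 * A$2$4 * A$3$1 * A$4$3 + A$1$2 * A$2$4 * A$3$3 * A$4$1
  + A$1$3 * A$2$1 * A$3$2 * A$4$4 - A$1$3 * A$2$1 * A$3$4 * A$4$2
  - A$1$3 * A$2$2 * A$3$1 * A$4$4 + A$1$3 * A$2$2 * A$3$4 * A$4$1
  + A$1$3 * A$2$4 * A$3$1 * A$4$2 - A$1$3 * A$2$4 * A$3$2 * A$4$1
  - A$1$4 * A$2$1 * A$3$2 * A$4$3 + A$1$4 * A$2$1 * A$3$3 * A$4$2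
  + A$1$4 * A$2$2 * A$3$1 * A$4$3 - A$1$4 * A$2$2 * A$3$3 * A$4$1
  - A$1$4 * A$2$3 * A$3$1 * A$4$2 + A$1$4 * A$2$3 * A$3$2 * A$4$1"
proof -
  have f1: "finite {2::4, 3, 4}" "1 \<notin> {2::4, 3, 4}" by auto
  have f2: "finite {3::4, 4}" "2 \<notin> {3::4, 4}" by auto
  have f3: "finite {4::4}" "3 \<notin> {4::4}" by auto
  show ?thesis
    unfolding det_def UNIV_4
    unfolding sum_over_permutations_insert[OF f1]
    unfolding sum_over_permutations_insert[OF f2]
    unfolding sum_over_permutations_insert[OF f3]
    unfolding permutes_sing
    by (simp add: sign_swap_id permutation_swap_id permutation_compose sign_compose sign_id swap_id_eq algebra_simps)
qed

text \<open>The Gram matrix is \<open>A J A\<^sup>T\<close> with \<open>J = diag(1, 1, 1, -1)\<close>; the sign is where the signature of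
  Minkowski space enters the whole argument.\<close>
lemma det_lorentz_gram:
  fixes A :: "real^4^4"
  shows "det (\<chi> i j. lorentz (A$i) (A$j)) = - (det A)\<^sup>2"
proof -
  define s :: "4 \<Rightarrow> real" where "s j = (if j = 4 then -1 else 1)" for j
  define J :: "real^4^4" where "J = (\<chi> i j. if i = j then s i else 0)"
  have s: "s 1 = 1" "s 2 = 1" "s 3 = 1" "s 4 = -1"
    by (simp_all add: s_def)
  have "(A ** J) $ i $ j = A$i$j * s j" for i j
    by (simp add: matrix_matrix_mult_def J_def if_distrib cong: if_cong)
  then have "(A ** J ** transpose A) $ i $ j = lorentz (A$i) (A$j)" for i j
    unfolding matrix_matrix_mult_def[of "A ** J"]
    by (simp add: transpose_def sum_4 s lorentz_def)
  then have "(\<chi> i j. lorentz (A$i) (A$j)) = A ** J ** transpose A"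
    by (simp add: vec_eq_iff)
  moreover have "det J = prod s UNIV"
    by (subst det_diagonal) (simp_all add: J_def)
  moreover have "prod s UNIV = -1"
    unfolding UNIV_4 by (simp add: s)
  ultimately show ?thesis
    by (simp add: det_mul power2_eq_square)
qed

lemma exhaust_5: "x = 1 \<or> x = 2 \<or> x = 3 \<or> x = 4 \<or> x = 5" for x :: 5
proof (induct x)
  case (of_int z)
  then have "z = 0 \<or> z = 1 \<or> z = 2 \<or> z = 3 \<or> z = 4" by auto
  then show ?case by auto
qed

lemma UNIV_5: "UNIV = {1, 2, 3, 4, 5::5}"
  using exhaust_5 by auto

lemma sum_5: "sum f (UNIV::5 set) = f 1 + f 2 + f 3 + f 4 + f 5"
proof -
  have "(1::5) \<notin> {2, 3, 4, 5}" "(2::5) \<notin> {3, 4, 5}" "(3::5) \<notin> {4, 5}" "(4::5) \<notin> {5}"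
    by simp_all
  then show ?thesis
    unfolding UNIV_5 by (simp only: sum.insert finite.intros sum.empty add.assoc add_0_right empty_iff not_False_eq_True simp_thms)
qed

text \<open>The coefficients are kept as five separate reals because the kernel computation below treats
  each of them by its own polynomial identity.\<close>
lemma five_vectors_dependent:
  fixes p0 p1 p2 p3 p4 :: "real^4"
  obtains k0 k1 k2 k3 k4 :: real
  where "k0 \<noteq> 0 \<or> k1 \<noteq> 0 \<or> k2 \<noteq> 0 \<or> k3 \<noteq> 0 \<or> k4 \<noteq> 0"
    "k0 *\<^sub>R p0 + k1 *\<^sub>R p1 + k2 *\<^sub>R p2 + k3 *\<^sub>R p3 + k4 *\<^sub>R p4 = 0"
proof -
  define A :: "real^5^4" where
    "A = (\<chi> i j. if j = 1 then p0$i else if j = 2 then p1$i else if j = 3 then p2$i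
                 else if j = 4 then p3$i else p4$i)"
  have "rank A \<le> 4"
    using rank_bound[of A] by simp
  then obtain k where k: "k \<noteq> 0" "A *v k = 0"
    using matrix_nonfull_linear_equations_eq[of A] by auto
  show thesis
  proof (rule that[of "k$1" "k$2" "k$3" "k$4" "k$5"])
    show "k$1 \<noteq> 0 \<or> k$2 \<noteq> 0 \<or> k$3 \<noteq> 0 \<or> k$4 \<noteq> 0 \<or> k$5 \<noteq> 0"
    proof (rule ccontr)
      assume "\<not> ?thesis"
      then have "k$i = 0" for i
        using exhaust_5[of i] by auto
      with k(1) show False by (simp add: vec_eq_iff)
    qed
    show "k$1 *\<^sub>R p0 + k$2 *\<^sub>R p1 + k$3 *\<^sub>R p2 + k$4 *\<^sub>R p3 + k$5 *\<^sub>R p4 = 0"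
    proof -
      have "(A *v k) $ i = (k$1 *\<^sub>R p0 + k$2 *\<^sub>R p1 + k$3 *\<^sub>R p2 + k$4 *\<^sub>R p3 + k$5 *\<^sub>R p4) $ i" for i
        by (simp add: matrix_vector_mult_def A_def sum_5 mult.commute)
      with k(2) show ?thesis by (metis vec_eq_iff)
    qed
  qed
qed

definition rows4 :: "real^4 \<Rightarrow> real^4 \<Rightarrow> real^4 \<Rightarrow> real^4 \<Rightarrow> real^4^4" where
  "rows4 p q r s = (\<chi> i. if i = 1 then p else if i = 2 then q else if i = 3 then r else s)"

lemma rows4_nth [simp]:
  "rows4 p q r s $ 1 = p" "rows4 p q r s $ 2 = q" "rows4 p q r s $ 3 = r" "rows4 p q r s $ 4 = s"
  by (simp_all add: rows4_def)

definition gram_det :: "real^4 \<Rightarrow> real^4 \<Rightarrow> real^4 \<Rightarrow> real^4 \<Rightarrow> real" where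
  "gram_det p q r s = det (\<chi> i j. lorentz (rows4 p q r s $ i) (rows4 p q r s $ j))"

text \<open>Four vectors spanning \<open>\<real>\<^sup>4\<close> would have a strictly negative Gram determinant.\<close>
lemma gram_det_nonneg_imp_normal:
  assumes "0 \<le> gram_det p q r s"
  obtains l where "l \<noteq> 0" "l \<bullet> p = 0" "l \<bullet> q = 0" "l \<bullet> r = 0" "l \<bullet> s = 0"
proof -
  have "det (rows4 p q r s) = 0"
    using assms by (simp add: gram_det_def det_lorentz_gram)
  then have "rank (rows4 p q r s) \<noteq> CARD(4)"
    by (simp add: det_eq_0_rank)
  then obtain l where l: "l \<noteq> 0" "rows4 p q r s *v l = 0"
    using matrix_nonfull_linear_equations_eq by blast
  then have "l \<bullet> rows4 p q r s $ i = 0" for i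
    by (metis inner_commute matrix_vector_mul_component zero_index)
  from this[of 1] this[of 2] this[of 3] this[of 4] l(1) show thesis
    by (intro that) simp_all
qed

lemma lorentz_sym: "lorentz x y = lorentz y x"
  by (simp add: lorentz_def mult.commute)

lemma lorentz_lincomb5:
  "lorentz x (k0 *\<^sub>R p0 + k1 *\<^sub>R p1 + k2 *\<^sub>R p2 + k3 *\<^sub>R p3 + k4 *\<^sub>R p4)
   = k0 * lorentz x p0 + k1 * lorentz x p1 + k2 * lorentz x p2 + k3 * lorentz x p3 + k4 * lorentz x p4"
  by (simp add: lorentz_def algebra_simps)

section \<open>Gram matrices of null quartic curves\<close>

text \<open>
  The numbers \<open>r0, \<dots>, r4\<close> are twice the entries of \<open>\<Gamma> k\<close>, where \<open>\<Gamma>\<close> is the Gram matrix described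
  above. Here is why \<open>m\<close> annihilates the kernel of \<open>\<Gamma>\<close>, and where the multipliers in the proof
  come from. Let \<open>J\<close> be the matrix of the invariant form on binary quartics, which has the entries
  \<open>1, -4, 6, -4, 1\<close> on the antidiagonal, and put \<open>E = e + ac/2\<close> and \<open>D = b\<^sup>2 - 4ac\<close>. Then
  \<open>J\<^sup>-\<^sup>1 \<Gamma> = E + T\<close>, where \<open>T\<close> does not depend on \<open>e\<close> and satisfies \<open>T (T - D/8) (T - D/6) = 0\<close>.
  On the kernel \<open>T = -E\<close>, so \<open>E (E + D/8) (E + D/6) = m / 96\<close> is zero there. The multipliers are
  the entries of \<open>96 Q J\<^sup>-\<^sup>1\<close>, where \<open>Q\<close> is the quotient of this cubic by \<open>T + E\<close>.
\<close>
lemma gram_kernel: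
  fixes a b c e k0 k1 k2 k3 k4 :: real
  defines "m \<equiv> (2*e + a*c) * (8*e + b^2) * (6*e + b^2 - a*c)"
  defines "r0 \<equiv> 2*e*k4 - a*b*k3 - a^2*k2"
    and "r1 \<equiv> 2*a^2*k1 + a*b*k2 - (8*e + 2*a*c + b^2)*k3 - b*c*k4"
    and "r2 \<equiv> a*b*k1 - a^2*k0 + (12*e + 4*a*c + 2*b^2)*k2 + b*c*k3 - c^2*k4"
    and "r3 \<equiv> 2*c^2*k3 + b*c*k2 - (8*e + 2*a*c + b^2)*k1 - a*b*k0"
    and "r4 \<equiv> 2*e*k0 - b*c*k1 - c^2*k2"
  assumes eqs: "r0 = 0" "r1 = 0" "r2 = 0" "r3 = 0" "r4 = 0"
  shows "m * k0 = 0" "m * k1 = 0" "m * k2 = 0" "m * k3 = 0" "m * k4 = 0"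
proof -
  note r_defs = r0_def r1_def r2_def r3_def r4_def
  have "2 * m * k0 = (4*c^4) * r0
      + (-2*b*c^3) * r1
      + (2*b^2*c^2 + 8*c^2*e) * r2
      + (-2*b^3*c - 12*b*c*e) * r3
      + (-4*a^2*c^2 + 6*a*b^2*c + 32*a*c*e + 2*b^4 + 28*b^2*e + 96*e^2) * r4"
    unfolding m_def r_defs by algebra
  then show "m * k0 = 0" by (simp add: eqs)
  have "2 * m * k1 = (-2*b*c^3) * r0
      + (a*c^3 - 6*c^2*e) * r1
      + (-a*b*c^2 + 2*b*c*e) * r2
      + (a^2*c^2 - 2*a*c*e - 4*b^2*e - 24*e^2) * r3
      + (-2*a*b^3 - 12*a*b*e) * r4"
    unfolding m_def r_defs by algebra
  then show "m * k1 = 0" by (simp add: eqs)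
  have "2 * m * k2 = (2*b^2*c^2 + 8*c^2*e) * r0
      + (-a*b*c^2 + 2*b*c*e) * r1
      + (a*b^2*c + 2*b^2*e + 16*e^2) * r2
      + (-(a^2)*b*c + 2*a*b*e) * r3
      + (2*a^2*b^2 + 8*a^2*e) * r4"
    unfolding m_def r_defs by algebra
  then show "m * k2 = 0" by (simp add: eqs)
  have "2 * m * k3 = (-2*b^3*c - 12*b*c*e) * r0
      + (a^2*c^2 - 2*a*c*e - 4*b^2*e - 24*e^2) * r1
      + (-(a^2)*b*c + 2*a*b*e) * r2
      + (a^3*c - 6*a^2*e) * r3
      + (-2*a^3*b) * r4"
    unfolding m_def r_defs by algebra
  then show "m * k3 = 0" by (simp add: eqs)
  have "2 * m * k4 = (-4*a^2*c^2 + 6*a*b^2*c + 32*a*c*e + 2*b^4 + 28*b^2*e + 96*e^2) * r0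
      + (-2*a*b^3 - 12*a*b*e) * r1
      + (2*a^2*b^2 + 8*a^2*e) * r2
      + (-2*a^3*b) * r3
      + (4*a^4) * r4"
    unfolding m_def r_defs by algebra
  then show "m * k4 = 0" by (simp add: eqs)
qed

text \<open>
  The entries of this Gram matrix are the coefficients of
  \<open>\<langle>V(s), V(t)\<rangle> = - (s - t)\<^sup>2 (\<gamma>(s,t)\<^sup>2 + C (s - t)\<^sup>2) / 2\<close>, where \<open>\<gamma>\<close> is the polar form of
  \<open>g = a + b t + c t\<^sup>2\<close> and \<open>C\<close> is a free constant, encoded by \<open>e\<close>. In a nontrivial relation
  between the five vectors some \<open>p\<^sub>j\<close> has a nonzero coefficient, so a vector orthogonal to the
  other four is orthogonal to \<open>p\<^sub>j\<close> too. It exists because the Gram determinant of the other four is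
  not negative.
\<close>
lemma null_curve_gram_normal:
  fixes p0 p1 p2 p3 p4 :: "real^4" and a b c e :: real
  defines "P \<equiv> 2*a*c + b^2"
  assumes G: "lorentz p0 p0 = 0" "lorentz p0 p1 = 0" "lorentz p0 p2 = -(a^2)/2"
    "lorentz p0 p3 = -(a*b)/2" "lorentz p0 p4 = e"
    "lorentz p1 p1 = a^2" "lorentz p1 p2 = a*b/2" "lorentz p1 p3 = -(4*e + P/2)"
    "lorentz p1 p4 = -(b*c)/2"
    "lorentz p2 p2 = 6*e + P" "lorentz p2 p3 = b*c/2" "lorentz p2 p4 = -(c^2)/2"
    "lorentz p3 p3 = c^2" "lorentz p3 p4 = 0" "lorentz p4 p4 = 0"
  obtains l where "l \<noteq> 0" "l \<bullet> p0 = 0" "l \<bullet> p1 = 0" "l \<bullet> p2 = 0" "l \<bullet> p3 = 0" "l \<bullet> p4 = 0"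
proof -
  note G' = G lorentz_sym[of p1 p0] lorentz_sym[of p2 p0] lorentz_sym[of p3 p0] lorentz_sym[of p4 p0]
    lorentz_sym[of p2 p1] lorentz_sym[of p3 p1] lorentz_sym[of p4 p1]
    lorentz_sym[of p3 p2] lorentz_sym[of p4 p2] lorentz_sym[of p4 p3]
  obtain k0 k1 k2 k3 k4 where k: "k0 \<noteq> 0 \<or> k1 \<noteq> 0 \<or> k2 \<noteq> 0 \<or> k3 \<noteq> 0 \<or> k4 \<noteq> 0"
    and rel: "k0 *\<^sub>R p0 + k1 *\<^sub>R p1 + k2 *\<^sub>R p2 + k3 *\<^sub>R p3 + k4 *\<^sub>R p4 = 0"
    by (rule five_vectors_dependent)
  have ker: "k0 * lorentz x p0 + k1 * lorentz x p1 + k2 * lorentz x p2 + k3 * lorentz x p3 + k4 * lorentz x p4 = 0" for x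
    using lorentz_lincomb5[of x k0 p0 k1 p1 k2 p2 k3 p3 k4 p4] unfolding rel by (simp add: lorentz_def)
  define m where "m = (2*e + a*c) * (8*e + b^2) * (6*e + b^2 - a*c)"
  have "m * k0 = 0 \<and> m * k1 = 0 \<and> m * k2 = 0 \<and> m * k3 = 0 \<and> m * k4 = 0"
    unfolding m_def
    by (intro conjI gram_kernel[of e k4 a b k3 k2 k1 c k0])
      (use ker[of p0] ker[of p1] ker[of p2] ker[of p3] ker[of p4] in \<open>simp_all add: G' P_def field_simps\<close>)
  with k have "m = 0" by auto
  then have "2*e + a*c = 0 \<or> 8*e + b^2 = 0 \<or> 6*e + b^2 - a*c = 0"
    unfolding m_def by simp
  then consider "e = -(a*c)/2" | "e = -(b^2)/8" | "e = (a*c - b^2)/6"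
    by (elim disjE) auto
  then have minors: "0 \<le> gram_det p1 p2 p3 p4 \<and> 0 \<le> gram_det p0 p2 p3 p4 \<and> 0 \<le> gram_det p0 p1 p3 p4
     \<and> 0 \<le> gram_det p0 p1 p2 p4 \<and> 0 \<le> gram_det p0 p1 p2 p3"
  proof cases
    \<comment> \<open>At a double root of the determinant the Gram matrix has rank at most 3.\<close>
    case 1
    have "gram_det p1 p2 p3 p4 = 0" "gram_det p0 p2 p3 p4 = 0" "gram_det p0 p1 p3 p4 = 0"
      "gram_det p0 p1 p2 p4 = 0" "gram_det p0 p1 p2 p3 = 0"
      unfolding gram_det_def det_4 by (simp_all add: G' 1 P_def field_simps, algebra+)
    then show ?thesis by simp
  next
    case 2
    have "gram_det p1 p2 p3 p4 = 0" "gram_det p0 p2 p3 p4 = 0" "gram_det p0 p1 p3 p4 = 0"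
      "gram_det p0 p1 p2 p4 = 0" "gram_det p0 p1 p2 p3 = 0"
      unfolding gram_det_def det_4 by (simp_all add: G' 2 P_def field_simps, algebra+)
    then show ?thesis by simp
  next
    \<comment> \<open>If \<open>D \<noteq> 0\<close> and \<open>g \<noteq> 0\<close>, the kernel is now spanned by \<open>J\<^sup>-\<^sup>1\<close> applied to the coefficient vector
      of \<open>g\<^sup>2\<close>. The adjugate of a singular symmetric matrix is a multiple of the tensor square of a
      kernel vector; the entries of this one are, up to sign and scale, the factors next to \<open>D\<close>.\<close>
    case 3
    define D where "D = b^2 - 4*a*c"
    have "gram_det p1 p2 p3 p4 = (D * (6*c^2) / 36)^2" "gram_det p0 p2 p3 p4 = (D * (3*b*c) / 36)^2"
      "gram_det p0 p1 p3 p4 = (D * P / 36)^2" "gram_det p0 p1 p2 p4 = (D * (3*a*b) / 36)^2"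
      "gram_det p0 p1 p2 p3 = (D * (6*a^2) / 36)^2"
      unfolding gram_det_def det_4 by (simp_all add: G' 3 P_def D_def field_simps, algebra+)
    then show ?thesis by simp
  qed
  \<comment> \<open>By this relation a normal of four of the vectors is normal to the fifth if that one has a
    nonzero coefficient.\<close>
  have dep: "l \<bullet> (k0 *\<^sub>R p0 + k1 *\<^sub>R p1 + k2 *\<^sub>R p2 + k3 *\<^sub>R p3 + k4 *\<^sub>R p4) = 0" for l
    unfolding rel by simp
  from k consider "k0 \<noteq> 0" | "k1 \<noteq> 0" | "k2 \<noteq> 0" | "k3 \<noteq> 0" | "k4 \<noteq> 0" by blast
  then show thesis
  proof cases
    case 1
    obtain l where "l \<noteq> 0" "l \<bullet> p1 = 0" "l \<bullet> p2 = 0" "l \<bullet> p3 = 0" "l \<bullet> p4 = 0"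
      using gram_det_nonneg_imp_normal minors by metis
    with dep[of l] 1 that show thesis by (simp add: inner_add_right)
  next
    case 2
    obtain l where "l \<noteq> 0" "l \<bullet> p0 = 0" "l \<bullet> p2 = 0" "l \<bullet> p3 = 0" "l \<bullet> p4 = 0"
      using gram_det_nonneg_imp_normal minors by metis
    with dep[of l] 2 that show thesis by (simp add: inner_add_right)
  next
    case 3
    obtain l where "l \<noteq> 0" "l \<bullet> p0 = 0" "l \<bullet> p1 = 0" "l \<bullet> p3 = 0" "l \<bullet> p4 = 0"
      using gram_det_nonneg_imp_normal minors by metis
    with dep[of l] 3 that show thesis by (simp add: inner_add_right)
  next
    case 4
    obtain l where "l \<noteq> 0" "l \<bullet> p0 = 0" "l \<bullet> p1 = 0" "l \<bullet> p2 = 0" "l \<bullet> p4 = 0"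
      using gram_det_nonneg_imp_normal minors by metis
    with dep[of l] 4 that show thesis by (simp add: inner_add_right)
  next
    case 5
    obtain l where "l \<noteq> 0" "l \<bullet> p0 = 0" "l \<bullet> p1 = 0" "l \<bullet> p2 = 0" "l \<bullet> p3 = 0"
      using gram_det_nonneg_imp_normal minors by metis
    with dep[of l] 5 that show thesis by (simp add: inner_add_right)
  qed
qed

lemma degree_square: "degree (p * p) = 2 * degree (p :: real poly)"
  by (cases "p = 0") (simp_all add: degree_mult_eq)

definition coeff_vec :: "real poly \<Rightarrow> real poly \<Rightarrow> real poly \<Rightarrow> real poly \<Rightarrow> nat \<Rightarrow> real^4" where
  "coeff_vec x y z s n =
    (\<chi> i. if i = 1 then coeff x n else if i = 2 then coeff y n else if i = 3 then coeff z n else coeff s n)"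

lemma lorentz_coeff_vec:
  "lorentz (coeff_vec x y z s i) (coeff_vec x y z s j) =
    coeff x i * coeff x j + coeff y i * coeff y j + coeff z i * coeff z j - coeff s i * coeff s j"
  by (simp add: lorentz_def coeff_vec_def)

lemma inner_coeff_vec:
  "l \<bullet> coeff_vec x y z s i = l$1 * coeff x i + l$2 * coeff y i + l$3 * coeff z i + l$4 * coeff s i"
  by (simp add: inner_vec_def sum_4 coeff_vec_def)

lemma coeff_lorentz_square:
  "coeff (x * x + y * y + z * z - s * s) m =
    (\<Sum>i\<le>m. lorentz (coeff_vec x y z s i) (coeff_vec x y z s (m - i)))"
  by (simp add: coeff_mult lorentz_coeff_vec sum.distrib sum_subtractf)

lemma coeff_vec_pderiv:
  "coeff_vec (pderiv x) (pderiv y) (pderiv z) (pderiv s) i = real (Suc i) *\<^sub>R coeff_vec x y z s (Suc i)"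
  by (simp add: vec_eq_iff coeff_vec_def coeff_pderiv)

text \<open>
  The coefficient of \<open>t\<^sup>m\<close> in \<open>\<langle>V, V\<rangle> = 0\<close> and in \<open>\<langle>V', V'\<rangle> = g\<^sup>2\<close> involves only the entries
  \<open>G i j\<close> of the Gram matrix with \<open>i + j = m\<close> and \<open>i + j = m + 2\<close>, respectively. So the system
  splits by \<open>i + j\<close>. Only for \<open>i + j = 4\<close> are there fewer equations than unknowns, which leaves
  \<open>G 0 4\<close> free.
\<close>
lemma null_quartic_normal:
  fixes x y z s g :: "real poly"
  assumes null: "x * x + y * y + z * z = s * s"
    and speed: "pderiv x * pderiv x + pderiv y * pderiv y + pderiv z * pderiv z
                 = pderiv s * pderiv s + g * g"
    and deg: "degree x \<le> 4" "degree y \<le> 4" "degree z \<le> 4"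
  obtains l :: "real^4" where "l \<noteq> 0"
    "smult (l$1) x + smult (l$2) y + smult (l$3) z + smult (l$4) s = 0"
proof -
  have "2 * degree s \<le> 2 * 4"
    unfolding degree_square[symmetric] null[symmetric]
    by (intro degree_add_le) (use deg in \<open>simp_all add: degree_square\<close>)
  then have degs: "degree s \<le> 4" by simp
  define v where "v = coeff_vec x y z s"
  define G where "G i j = lorentz (v i) (v j)" for i j
  have G_sym: "G i j = G j i" for i j
    by (simp add: G_def lorentz_sym)
  have v0: "v i = 0" if "i > 4" for i
    using that deg degs by (simp add: v_def coeff_vec_def vec_eq_iff coeff_eq_0)
  have G0: "G i j = 0" if "i > 4 \<or> j > 4" for i j
    using that v0[of i] v0[of j] by (auto simp: G_def lorentz_def)
  have null_coeff: "(\<Sum>i\<le>m. G i (m - i)) = 0" for m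
    unfolding G_def v_def coeff_lorentz_square[symmetric] by (simp add: null)
  have speed_coeff: "(\<Sum>i\<le>m. real (Suc i) * real (Suc (m - i)) * G (Suc i) (Suc (m - i))) = coeff (g * g) m" for m
  proof -
    have "coeff (g * g) m = coeff (pderiv x * pderiv x + pderiv y * pderiv y + pderiv z * pderiv z
        - pderiv s * pderiv s) m"
      by (simp add: speed)
    also have "\<dots> = (\<Sum>i\<le>m. real (Suc i) * real (Suc (m - i)) * G (Suc i) (Suc (m - i)))"
      unfolding coeff_lorentz_square coeff_vec_pderiv G_def v_def
      by (simp add: lorentz_def algebra_simps)
    finally show ?thesis ..
  qed
  note swap = G_sym[of "Suc 0" 0] G_sym[of 2 0] G_sym[of 3 0] G_sym[of 4 0]
    G_sym[of 2 "Suc 0"] G_sym[of 3 "Suc 0"] G_sym[of 4 "Suc 0"] G_sym[of 3 2] G_sym[of 4 2] G_sym[of 4 3]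
  note expand = atMost_nat_numeral atMost_Suc numeral_2_eq_2[symmetric] G0
  have n: "G 0 0 = 0" "2 * G 0 1 = 0" "2 * G 0 2 + G 1 1 = 0" "2 * G 0 3 + 2 * G 1 2 = 0"
    "2 * G 0 4 + 2 * G 1 3 + G 2 2 = 0" "2 * G 1 4 + 2 * G 2 3 = 0" "2 * G 2 4 + G 3 3 = 0"
    "2 * G 3 4 = 0" "G 4 4 = 0"
    using null_coeff[of 0] null_coeff[of 1] null_coeff[of 2] null_coeff[of 3] null_coeff[of 4]
      null_coeff[of 5] null_coeff[of 6] null_coeff[of 7] null_coeff[of 8]
    by (simp_all add: expand swap)
  \<comment> \<open>Here \<open>\<langle>V', V'\<rangle>\<close> has formal degree 6; its two top coefficients are multiples of \<open>G 3 4\<close> and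
    \<open>G 4 4\<close>, which vanish because \<open>V\<close> is null.\<close>
  have "coeff (g * g) m = 0" if m: "m > 4" for m
  proof -
    consider "m = 5" | "m = 6" | "m > 6" using m by linarith
    then show ?thesis
    proof cases
      case 1
      then show ?thesis using speed_coeff[of 5] n by (simp add: expand swap)
    next
      case 2
      then show ?thesis using speed_coeff[of 6] n by (simp add: expand)
    next
      case 3
      have "G (Suc i) (Suc (m - i)) = 0" if "i \<le> m" for i
        using that 3 by (intro G0) linarith
      then show ?thesis unfolding speed_coeff[symmetric] by simp
    qed
  qed
  then have "degree (g * g) \<le> 4"
    by (intro degree_le) auto
  then have degg: "degree g \<le> 2"
    unfolding degree_square by simp
  define a b c where abc: "a = coeff g 0" "b = coeff g 1" "c = coeff g 2"
  have g0: "coeff g i = 0" if "i > 2" for i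
    using that degg by (simp add: coeff_eq_0)
  have gg: "coeff (g * g) 0 = a^2" "coeff (g * g) 1 = 2*a*b" "coeff (g * g) 2 = 2*a*c + b^2"
    "coeff (g * g) 3 = 2*b*c" "coeff (g * g) 4 = c^2"
    unfolding coeff_mult by (simp_all add: expand g0 abc power2_eq_square)
  have sp: "G 1 1 = a^2" "4 * G 1 2 = 2*a*b" "6 * G 1 3 + 4 * G 2 2 = 2*a*c + b^2"
    "8 * G 1 4 + 12 * G 2 3 = 2*b*c" "16 * G 2 4 + 9 * G 3 3 = c^2"
    using speed_coeff[of 0] speed_coeff[of 1] speed_coeff[of 2] speed_coeff[of 3] speed_coeff[of 4]
    unfolding gg
    by (simp_all add: expand swap)
  have "2 * G 1 3 = - 8 * G 0 4 - (2*a*c + b^2)"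
    using n(5) sp(3) by linarith
  then have G13: "G 1 3 = -(4 * G 0 4 + (2*a*c + b^2)/2)"
    by (simp add: field_simps)
  obtain l where l: "l \<noteq> 0" "l \<bullet> v 0 = 0" "l \<bullet> v 1 = 0" "l \<bullet> v 2 = 0" "l \<bullet> v 3 = 0" "l \<bullet> v 4 = 0"
  proof (rule null_curve_gram_normal[of "v 0" "v 1" "v 2" a "v 3" b "v 4" "G 0 4" c])
  qed (use n sp G13 in \<open>unfold G_def[symmetric], simp_all\<close>)
  show thesis
  proof (rule that[OF l(1)], rule poly_eqI)
    fix i :: nat
    consider "i = 0" | "i = 1" | "i = 2" | "i = 3" | "i = 4" | "i > 4" by linarith
    then have "l \<bullet> v i = 0"
      by cases (use l v0 in simp_all)
    then show "coeff (smult (l$1) x + smult (l$2) y + smult (l$3) z + smult (l$4) s) i = coeff 0 i"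
      by (simp add: v_def inner_coeff_vec)
  qed
qed

section \<open>Polynomial curves\<close>

definition poly_vec :: "real poly \<Rightarrow> real poly \<Rightarrow> real poly \<Rightarrow> real \<Rightarrow> real^3" where
  "poly_vec x y z t = vector [poly x t, poly y t, poly z t]"

lemma inner_poly_vec: "u \<bullet> poly_vec x y z t = u$1 * poly x t + u$2 * poly y t + u$3 * poly z t"
  by (simp add: inner_vec_def sum_3 poly_vec_def)

lemma poly_vec_inner_poly_vec:
  "poly_vec x y z t \<bullet> poly_vec x' y' z' t = poly (x * x' + y * y' + z * z') t"
  by (simp add: inner_vec_def sum_3 poly_vec_def)

lemma velocity_poly_vec: "velocity (poly_vec x y z) = poly_vec (pderiv x) (pderiv y) (pderiv z)"
proof
  fix t
  have split: "poly_vec x y z t = poly x t *\<^sub>R axis 1 1 + poly y t *\<^sub>R axis 2 1 + poly z t *\<^sub>R axis 3 1"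
    for x y z t
    by (simp add: poly_vec_def vec_eq_iff forall_3 axis_def)
  have "(poly_vec x y z has_vector_derivative poly_vec (pderiv x) (pderiv y) (pderiv z) t) (at t)"
    unfolding split[abs_def]
    by (rule derivative_eq_intros poly_DERIV refl | simp)+
  then show "velocity (poly_vec x y z) t = poly_vec (pderiv x) (pderiv y) (pderiv z) t"
    unfolding velocity_def by (rule vector_derivative_at)
qed

lemma planar_if_velocity_orthogonal:
  assumes "n \<noteq> 0" and "\<And>t. n \<bullet> velocity (poly_vec x y z) t = 0"
  shows "planar_curve (poly_vec x y z)"
proof -
  define q where "q = smult (n$1) x + smult (n$2) y + smult (n$3) z"
  have q: "poly q t = n \<bullet> poly_vec x y z t" for t
    by (simp add: q_def inner_poly_vec)
  have "poly (pderiv q) t = 0" for t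
    using assms(2)[of t] by (simp add: q_def velocity_poly_vec inner_poly_vec pderiv_add pderiv_smult)
  then have "pderiv q = 0"
    using poly_all_0_iff_0 by blast
  then obtain d where "q = [:d:]"
    unfolding pderiv_eq_0_iff by (metis degree_eq_zeroE)
  then have "n \<bullet> poly_vec x y z t = d" for t
    using q[of t] by simp
  with assms(1) show ?thesis
    unfolding planar_curve_def by blast
qed

text \<open>The Gram determinant of \<open>u, v, w\<close>, expanded along its first row.\<close>
lemma triple_product_square:
  fixes u v w :: "real^3"
  shows "(u \<bullet> cross3 v w)\<^sup>2 =
    (u \<bullet> u) * ((v \<bullet> v) * (w \<bullet> w) - (v \<bullet> w)\<^sup>2)
    - (u \<bullet> v) * ((u \<bullet> v) * (w \<bullet> w) - (v \<bullet> w) * (u \<bullet> w))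
    + (u \<bullet> w) * ((u \<bullet> v) * (v \<bullet> w) - (v \<bullet> v) * (u \<bullet> w))"
  unfolding inner_vec_def sum_3 cross3_def by (simp, algebra)

lemma norm_cross_square: "(norm (cross3 v w))\<^sup>2 = (v \<bullet> v) * (w \<bullet> w) - (v \<bullet> w)\<^sup>2"
  using norm_cross_dot[of v w] by (simp add: power_mult_distrib power2_norm_eq_inner)

lemma pderiv_null:
  fixes x y z s :: "real poly"
  assumes "x * x + y * y + z * z = s * s"
  shows "x * pderiv x + y * pderiv y + z * pderiv z = s * pderiv s"
proof -
  have "pderiv (x * x + y * y + z * z) = pderiv (s * s)"
    by (simp add: assms)
  then have "2 * (x * pderiv x + y * pderiv y + z * pderiv z) = 2 * (s * pderiv s)"
    by (simp add: pderiv_add pderiv_mult algebra_simps)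
  then show ?thesis by (simp only: mult_cancel_left) simp
qed

section \<open>Helices are 2-PH curves\<close>

text \<open>
  With \<open>u \<bullet> v = c s\<close>, \<open>u \<bullet> v' = c s'\<close>, \<open>|v|\<^sup>2 = s\<^sup>2\<close> and \<open>v \<bullet> v' = s s'\<close>, every entry of the Gram
  determinant of \<open>u, v, v'\<close> except \<open>|v'|\<^sup>2\<close> is expressed by \<open>s\<close>, \<open>s'\<close> and \<open>c\<close>, and the determinant
  factors as \<open>(1 - c\<^sup>2) s\<^sup>2 (|v'|\<^sup>2 - s'\<^sup>2)\<close>.
\<close>
lemma helix_imp_two_PH:
  assumes reg: "regular_curve (poly_vec x0 y0 z0)" and np: "\<not> planar_curve (poly_vec x0 y0 z0)"
    and "helix (poly_vec x0 y0 z0)"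
  shows "two_PH_curve (poly_vec x0 y0 z0)"
proof -
  define x y z where xyz: "x = pderiv x0" "y = pderiv y0" "z = pderiv z0"
  define v where "v = poly_vec x y z"
  define w where "w = poly_vec (pderiv x) (pderiv y) (pderiv z)"
  have v: "velocity (poly_vec x0 y0 z0) = v"
    by (simp add: velocity_poly_vec v_def xyz)
  have w: "acceleration (poly_vec x0 y0 z0) = w"
    unfolding acceleration_def v by (simp add: velocity_poly_vec v_def w_def)
  have nz: "v t \<noteq> 0" for t
    using reg by (simp add: regular_curve_def v)
  obtain u c where u: "norm u = 1" and c: "\<And>t. u \<bullet> tangent_vector (poly_vec x0 y0 z0) t = c"
    using \<open>helix _\<close> unfolding helix_def by blast
  have uu: "u \<bullet> u = 1"
    using u by (simp add: norm_eq_1)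
  have uv: "u \<bullet> v t = c * norm (v t)" for t
    using c[of t] nz[of t] by (simp add: tangent_vector_def v field_simps)
  have "u \<noteq> 0"
    using u by auto
  then have c0: "c \<noteq> 0"
    using planar_if_velocity_orthogonal[of u x0 y0 z0] np uv by (auto simp: v)
  \<comment> \<open>Equality in the Cauchy-Schwarz inequality would make the velocity always parallel to \<open>u\<close>.\<close>
  have c1: "c\<^sup>2 \<noteq> 1"
  proof
    assume c1: "c\<^sup>2 = 1"
    obtain n where n: "n \<noteq> 0" "n \<bullet> u = 0"
      using orthogonal_to_vector_exists[of u] by (auto simp: orthogonal_def inner_commute)
    have "n \<bullet> v t = 0" for t
    proof -
      have "(v t - (u \<bullet> v t) *\<^sub>R u) \<bullet> (v t - (u \<bullet> v t) *\<^sub>R u) = v t \<bullet> v t - (u \<bullet> v t)\<^sup>2"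
        by (simp add: inner_diff uu inner_commute power2_eq_square)
      also have "\<dots> = 0"
        by (simp add: uv power_mult_distrib c1 power2_norm_eq_inner)
      finally have "v t = (u \<bullet> v t) *\<^sub>R u" by simp
      then have "n \<bullet> v t = (u \<bullet> v t) * (n \<bullet> u)"
        by (metis inner_scaleR_right)
      with n show ?thesis by simp
    qed
    with planar_if_velocity_orthogonal[OF n(1)] np show False
      by (auto simp: v)
  qed
  define s where "s = smult (1 / c) (smult (u$1) x + smult (u$2) y + smult (u$3) z)"
  have s: "poly s t = norm (v t)" for t
    using uv[of t] c0 by (simp add: s_def v_def inner_poly_vec)
  have null: "x * x + y * y + z * z = s * s"
  proof (rule poly_ext)
    fix t show "poly (x * x + y * y + z * z) t = poly (s * s) t"
      unfolding poly_vec_inner_poly_vec[symmetric] v_def[symmetric]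
      by (simp add: s dot_square_norm power2_eq_square)
  qed
  define r where "r = smult (u$1) (y * pderiv z - z * pderiv y) + smult (u$2) (z * pderiv x - x * pderiv z)
    + smult (u$3) (x * pderiv y - y * pderiv x)"
  have r: "poly r t = u \<bullet> cross3 (v t) (w t)" for t
    by (simp add: r_def v_def w_def poly_vec_def cross3_def inner_vec_def sum_3)
  have "(norm (cross3 (v t) (w t)))\<^sup>2 = (poly (smult (1 / sqrt (1 - c\<^sup>2)) r) t)\<^sup>2" for t
  proof -
    have vv: "v t \<bullet> v t = (poly s t)\<^sup>2"
      by (simp add: s dot_square_norm)
    have vw: "v t \<bullet> w t = poly s t * poly (pderiv s) t"
      unfolding v_def w_def poly_vec_inner_poly_vec pderiv_null[OF null] by simp
    have uv': "u \<bullet> v t = c * poly s t"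
      by (simp add: uv s)
    have uw: "u \<bullet> w t = c * poly (pderiv s) t"
      using c0 by (simp add: s_def w_def inner_poly_vec pderiv_smult pderiv_add)
    have "(poly r t)\<^sup>2 = (1 - c\<^sup>2) * (norm (cross3 (v t) (w t)))\<^sup>2"
      unfolding r triple_product_square norm_cross_square uu vv vw uv' uw by algebra
    moreover have "c\<^sup>2 < 1"
    proof -
      have "\<bar>c * norm (v 0)\<bar> \<le> norm (v 0)"
        using Cauchy_Schwarz_ineq2[of u "v 0"] by (simp add: u uv)
      then have "\<bar>c\<bar> \<le> 1"
        using nz[of 0] by (simp add: abs_mult)
      then show ?thesis
        using c1 abs_square_le_1[of c] by (simp add: less_le)
    qed
    ultimately show ?thesis
      by (simp add: power_mult_distrib power_divide field_simps)
  qed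
  then show ?thesis
    unfolding two_PH_curve_def polynomial_norm_def v w using s by metis
qed

section \<open>Quintic 2-PH curves are helices\<close>

lemma nonvanishing_poly_sgn_const:
  fixes s :: "real poly"
  assumes "\<And>t. poly s t \<noteq> 0"
  shows "sgn (poly s t) = sgn (poly s t')"
proof -
  have "sgn (poly s a) = sgn (poly s b)" if "a < b" for a b
    using poly_IVT_pos[OF that, of s] poly_IVT_neg[OF that, of s] assms[of a] assms[of b] assms
    by (metis linorder_neqE_linordered_idom sgn_neg sgn_pos)
  then show ?thesis
    by (metis linorder_neqE_linordered_idom)
qed

text \<open>By Lagrange's identity \<open>q\<^sup>2 = s\<^sup>2 (|v'|\<^sup>2 - s'\<^sup>2)\<close>. Unique factorization of real polynomials turns
  \<open>s\<^sup>2 dvd q\<^sup>2\<close> into \<open>s dvd q\<close>, and \<open>g\<close> is the quotient.\<close>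
lemma speed_dvd_cross_norm:
  fixes x y z s q :: "real poly"
  assumes null: "x * x + y * y + z * z = s * s" and "s \<noteq> 0"
    and cross: "\<And>t. (norm (cross3 (poly_vec x y z t) (poly_vec (pderiv x) (pderiv y) (pderiv z) t)))\<^sup>2 = (poly q t)\<^sup>2"
  obtains g where "pderiv x * pderiv x + pderiv y * pderiv y + pderiv z * pderiv z = pderiv s * pderiv s + g * g"
proof -
  define W where "W = pderiv x * pderiv x + pderiv y * pderiv y + pderiv z * pderiv z"
  have eq: "q\<^sup>2 = s\<^sup>2 * (W - (pderiv s)\<^sup>2)"
  proof (rule poly_ext)
    fix t show "poly (q\<^sup>2) t = poly (s\<^sup>2 * (W - (pderiv s)\<^sup>2)) t"
      using cross[of t]
      unfolding norm_cross_square poly_vec_inner_poly_vec null pderiv_null[OF null] W_def[symmetric]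
      by (simp add: algebra_simps power2_eq_square)
  qed
  then have "s\<^sup>2 dvd q\<^sup>2" by simp
  then have "s dvd q"
    by simp
  then obtain g where "q = s * g" by (elim dvdE)
  with eq \<open>s \<noteq> 0\<close> have "W - (pderiv s)\<^sup>2 = g\<^sup>2"
    by (simp add: power_mult_distrib)
  then show thesis
    using that[of g] by (simp add: W_def algebra_simps power2_eq_square)
qed

text \<open>With \<open>u = (l\<^sub>1, l\<^sub>2, l\<^sub>3)\<close> the relation of \<open>null_quartic_normal\<close> says \<open>u \<bullet> v = - l\<^sub>4 s\<close>. The vector
  \<open>u\<close> is nonzero since otherwise \<open>l\<^sub>4 s = 0\<close>, and regularity keeps \<open>s\<close> away from zero.\<close>
lemma two_PH_imp_helix:
  assumes reg: "regular_curve (poly_vec x0 y0 z0)"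
    and deg: "degree x0 \<le> 5" "degree y0 \<le> 5" "degree z0 \<le> 5"
    and PH: "two_PH_curve (poly_vec x0 y0 z0)"
  shows "helix (poly_vec x0 y0 z0)"
proof -
  define x y z where xyz: "x = pderiv x0" "y = pderiv y0" "z = pderiv z0"
  define v where "v = poly_vec x y z"
  have v: "velocity (poly_vec x0 y0 z0) = v"
    by (simp add: velocity_poly_vec v_def xyz)
  have w: "acceleration (poly_vec x0 y0 z0) = poly_vec (pderiv x) (pderiv y) (pderiv z)"
    unfolding acceleration_def v by (simp add: velocity_poly_vec v_def)
  have nz: "v t \<noteq> 0" for t
    using reg by (simp add: regular_curve_def v)
  obtain s q where s: "\<And>t. (norm (v t))\<^sup>2 = (poly s t)\<^sup>2"
    and q: "\<And>t. (norm (cross3 (v t) (poly_vec (pderiv x) (pderiv y) (pderiv z) t)))\<^sup>2 = (poly q t)\<^sup>2"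
    using PH unfolding two_PH_curve_def polynomial_norm_def v w by blast
  have norm_v: "norm (v t) = \<bar>poly s t\<bar>" for t
    using s[of t] by (metis abs_norm_cancel real_sqrt_abs)
  have s_nz: "poly s t \<noteq> 0" for t
    using norm_v[of t] nz[of t] by auto
  have null: "x * x + y * y + z * z = s * s"
  proof (rule poly_ext)
    fix t show "poly (x * x + y * y + z * z) t = poly (s * s) t"
      unfolding poly_vec_inner_poly_vec[symmetric] v_def[symmetric]
      using s[of t] by (simp add: dot_square_norm power2_eq_square)
  qed
  obtain g where g: "pderiv x * pderiv x + pderiv y * pderiv y + pderiv z * pderiv z = pderiv s * pderiv s + g * g"
    using speed_dvd_cross_norm[OF null _ q[unfolded v_def]] s_nz by fastforce
  have "degree x \<le> 4" "degree y \<le> 4" "degree z \<le> 4"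
    using deg by (simp_all add: xyz degree_pderiv)
  then obtain l :: "real^4" where l: "l \<noteq> 0"
    and rel: "smult (l$1) x + smult (l$2) y + smult (l$3) z + smult (l$4) s = 0"
    using null_quartic_normal[OF null g] by blast
  define u :: "real^3" where "u = vector [l$1, l$2, l$3]"
  have uv: "u \<bullet> v t = - l$4 * poly s t" for t
  proof -
    have "poly (smult (l$1) x + smult (l$2) y + smult (l$3) z + smult (l$4) s) t = 0"
      by (simp add: rel)
    then show ?thesis
      by (simp add: v_def inner_poly_vec u_def)
  qed
  have "u \<noteq> 0"
  proof
    assume u: "u = 0"
    then have "l$4 = 0"
      using uv[of 0] s_nz[of 0] by simp
    moreover from u have "l$1 = 0" "l$2 = 0" "l$3 = 0"
      by (simp_all add: u_def vec_eq_iff forall_3)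
    ultimately show False
      using l by (simp add: vec_eq_iff forall_4)
  qed
  have "(u /\<^sub>R norm u) \<bullet> tangent_vector (poly_vec x0 y0 z0) t = - l$4 * sgn (poly s 0) / norm u" for t
  proof -
    have "sgn (poly s 0) = poly s t / \<bar>poly s t\<bar>"
      using nonvanishing_poly_sgn_const[OF s_nz, of 0 t] by (simp add: sgn_div_norm divide_inverse)
    then show ?thesis
      by (simp add: tangent_vector_def v uv norm_v divide_inverse)
  qed
  moreover have "norm (u /\<^sub>R norm u) = 1"
    using \<open>u \<noteq> 0\<close> by simp
  ultimately show ?thesis
    unfolding helix_def by blast
qed

theorem theorem1:
  fixes \<alpha> :: "real \<Rightarrow> real^3"
  assumes "polynomial_curve 5 \<alpha>"
    and "regular_curve \<alpha>"
    and "\<not> planar_curve \<alpha>"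
  shows "helix \<alpha> \<longleftrightarrow> two_PH_curve \<alpha>"
proof -
  obtain x y z where \<alpha>: "\<And>t. \<alpha> t = vector [poly x t, poly y t, poly z t]"
    and max: "Max {degree x, degree y, degree z} = 5"
    using assms(1) unfolding polynomial_curve_def by blast
  have eq: "\<alpha> = poly_vec x y z"
    by (simp add: fun_eq_iff \<alpha> poly_vec_def)
  have "degree x \<le> 5" "degree y \<le> 5" "degree z \<le> 5"
    using max by (auto simp flip: max)
  then show ?thesis
    using assms(2,3) helix_imp_two_PH two_PH_imp_helix unfolding eq by blast
qed

end
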